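(* If $G$ and $H$ are connected graphs, then $$s(G)\,s(H)\le \mathrm{gp}_{\rm d}(G\boxtimes H)\le \min\{\,s(G)n(H)+s(H)n(G)-s(G)s(H),\ n(G)\,\mathrm{gp}_{\rm d}(H),\ n(H)\,\mathrm{gp}_{\rm d}(G)\,\}.$$
   Context: All graphs are finite and simple; $n(G)$ is the order of $G$. For $X\subseteq V(G)$, two vertices $u,v$ are $X$-positionable if no shortest $u,v$-path has an internal vertex in $X$. $X$ is a dual general position set if every two vertices of $X$ are $X$-positionable and every two vertices of $V(G)\setminus X$ are $X$-positionable; $\mathrm{gp}_{\rm d}(G)$ is the maximum cardinality of such a set. A vertex is simplicial if its neighbourhood induces a complete subgraph; $s(G)$ is the number of simplicial vertices. The strong product $G\boxtimes H$ has vertex set $V(G)\times V(H)$, with $(g,h)$ and $(g',h')$ adjacent iff either $g=g'$ and $hh'\in E(H)$, or $gg'\in E(G)$ and $h=h'$, or $gg'\in E(G)$ and $hh'\in E(H)$. *)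

theory Defs
  imports "Graph_Theory.Graph_Theory"
begin

text \<open>
  Finite simple graphs are modelled by the locale \<^locale>\<open>pair_graph\<close>: finite, symmetric and
  loop-free, with every edge represented by both of its arcs. Note that \<^const>\<open>connected\<close>
  includes non-emptiness of the vertex set.
\<close>

definition neighbourhood :: "'a pair_pre_digraph \<Rightarrow> 'a \<Rightarrow> 'a set" where
  "neighbourhood G v = {u \<in> pverts G. (v, u) \<in> parcs G}"

definition simplicial :: "'a pair_pre_digraph \<Rightarrow> 'a \<Rightarrow> bool" where
  "simplicial G v \<longleftrightarrow>
     v \<in> pverts G \<and>
     complete_digraph (card (neighbourhood G v)) (with_proj G \<restriction> neighbourhood G v)"

definition num_simplicial :: "'a pair_pre_digraph \<Rightarrow> nat" where
  "num_simplicial G = card {v. simplicial G v}"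

definition path_between :: "'a pair_pre_digraph \<Rightarrow> 'a \<Rightarrow> 'a vwalk \<Rightarrow> 'a \<Rightarrow> bool" where
  "path_between G u p v \<longleftrightarrow> vpath p (with_proj G) \<and> hd p = u \<and> last p = v"

definition shortest_path :: "'a pair_pre_digraph \<Rightarrow> 'a \<Rightarrow> 'a vwalk \<Rightarrow> 'a \<Rightarrow> bool" where
  "shortest_path G u p v \<longleftrightarrow>
     path_between G u p v \<and> (\<forall>q. path_between G u q v \<longrightarrow> vwalk_length p \<le> vwalk_length q)"

definition internal_verts :: "'a vwalk \<Rightarrow> 'a set" where
  "internal_verts p = set (butlast (tl p))"

definition positionable :: "'a pair_pre_digraph \<Rightarrow> 'a set \<Rightarrow> 'a \<Rightarrow> 'a \<Rightarrow> bool" where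
  "positionable G X u v \<longleftrightarrow> (\<forall>p. shortest_path G u p v \<longrightarrow> internal_verts p \<inter> X = {})"

definition dual_gp_set :: "'a pair_pre_digraph \<Rightarrow> 'a set \<Rightarrow> bool" where
  "dual_gp_set G X \<longleftrightarrow>
     X \<subseteq> pverts G \<and>
     (\<forall>u\<in>X. \<forall>v\<in>X. u \<noteq> v \<longrightarrow> positionable G X u v) \<and>
     (\<forall>u\<in>pverts G - X. \<forall>v\<in>pverts G - X. u \<noteq> v \<longrightarrow> positionable G X u v)"

lemma dual_gp_set_empty: "dual_gp_set G {}"
  by (simp add: dual_gp_set_def positionable_def)

definition gp_dual :: "'a pair_pre_digraph \<Rightarrow> nat" where
  "gp_dual G = Max {card X | X. dual_gp_set G X}"

definition strong_product ::
  "'a pair_pre_digraph \<Rightarrow> 'b pair_pre_digraph \<Rightarrow> ('a \<times> 'b) pair_pre_digraph" (infixl "\<boxtimes>" 70) where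
  "G \<boxtimes> H =
     \<lparr> pverts = pverts G \<times> pverts H,
       parcs = {((g, h), (g', h')).
         g \<in> pverts G \<and> g' \<in> pverts G \<and> h \<in> pverts H \<and> h' \<in> pverts H \<and>
         (g = g' \<and> (h, h') \<in> parcs H \<or>
          (g, g') \<in> parcs G \<and> h = h' \<or>
          (g, g') \<in> parcs G \<and> (h, h') \<in> parcs H)} \<rparr>"

lemma pair_graph_strong_product:
  assumes "pair_graph G" and "pair_graph H"
  shows "pair_graph (G \<boxtimes> H)"
proof -
  interpret G: pair_graph G by fact
  interpret H: pair_graph H by fact
  let ?V = "pverts G \<times> pverts H"
  have "parcs (G \<boxtimes> H) \<subseteq> ?V \<times> ?V"
    by (auto simp: strong_product_def)
  then have "finite (parcs (G \<boxtimes> H))"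
    by (rule finite_subset) simp
  moreover have "symmetric (with_proj (G \<boxtimes> H))"
    unfolding symmetric_def
    by (rule symI) (auto simp: strong_product_def dest: G.arcs_symmetric H.arcs_symmetric)
  ultimately show ?thesis
    by unfold_locales (auto simp: strong_product_def dest: G.no_loops' H.no_loops')
qed

end

theory Submission
  imports Defs
begin

text \<open>
  A simplicial vertex is never internal to a shortest path, and the strong product of two
  simplicial vertices is simplicial, so any set of simplicial vertices, in particular their
  product, is a dual general position set. Conversely, if a vertex \<open>x\<close> of a dual general position
  set \<open>X\<close> has two distinct non-adjacent neighbours, then exactly one of them lies in \<open>X\<close>; hence
  \<open>x\<close> has no three pairwise non-adjacent neighbours. When neither \<open>g\<close> nor \<open>h\<close> is simplicial,
  \<open>(g, h)\<close> does have three such neighbours. The remaining bounds hold because the layers of the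
  product are isometric, so that \<open>X\<close> meets each layer in a dual general position set.
\<close>

section \<open>Paths and lazy walks\<close>

lemma path_between_singleton [simp]: "path_between G u [x] v \<longleftrightarrow> u = x \<and> v = x \<and> x \<in> pverts G"
  by (auto simp: path_between_def vpath_def vwalk_def)

lemma path_between_Cons2 [simp]:
  "path_between G u (x # y # p) v \<longleftrightarrow>
     u = x \<and> x \<in> pverts G \<and> (x, y) \<in> parcs G \<and> x \<notin> set (y # p) \<and> path_between G y (y # p) v"
  by (auto simp: path_between_def vpath_def vwalk_def)

lemma path_between_nonempty: "path_between G u p v \<Longrightarrow> p \<noteq> []"
  by (auto simp: path_between_def vpath_def vwalk_def)

lemma path_between_suffix:
  assumes "path_between G u (p @ q) v" and "q \<noteq> []"
  shows "path_between G (hd q) q v"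
proof -
  have "set (vwalk_arcs q) \<subseteq> parcs G"
    using assms set_vwalk_arcs_append2[of q p] by (auto simp: path_between_def vpath_def vwalk_def)
  with assms show ?thesis
    by (auto simp: path_between_def vpath_def vwalk_def)
qed

text \<open>An \<open>Id\<close> step is a pause, as arises when a projection collapses an arc. The
  path is built from the back: the first vertex \<open>x\<close> is prepended to the path found for
  the rest or, if \<open>x\<close> already occurs there, that path is cut down to its suffix from
  \<open>x\<close>. A pause always falls under the second case.\<close>

lemma path_of_lazy_walk:
  assumes "q \<noteq> []" and "set q \<subseteq> pverts G" and "set (vwalk_arcs q) \<subseteq> parcs G \<union> Id"
  shows "\<exists>p. path_between G (hd q) p (last q) \<and> length p \<le> length q"
  using assms
proof (induction q rule: induct_list012)
  case (2 x)
  then show ?case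
    by (intro exI[of _ "[x]"]) simp
next
  case (3 x y q)
  then obtain p where p: "path_between G y p (last (y # q))" "length p \<le> length (y # q)"
    by auto
  show ?case
  proof (cases "x \<in> set p")
    case True
    then obtain ps qs where "p = ps @ x # qs"
      by (meson split_list)
    with p have "path_between G x (x # qs) (last (y # q))"
      using path_between_suffix[of G y ps "x # qs"] by auto
    moreover have "length (x # qs) \<le> length (x # y # q)"
      using p \<open>p = ps @ x # qs\<close> by auto
    ultimately show ?thesis
      by (intro exI[of _ "x # qs"]) simp
  next
    case False
    obtain ps where ps: "p = y # ps"
      using p(1) by (cases p) (auto simp: path_between_def vpath_def vwalk_def)
    with False 3 have "(x, y) \<in> parcs G" "x \<in> pverts G"
      by auto
    with p ps False show ?thesis
      by (intro exI[of _ "x # p"]) auto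
  qed
qed simp

lemma shortest_path_le_lazy_walk:
  assumes "shortest_path G u p v" and "q \<noteq> []" and "set q \<subseteq> pverts G"
    and "set (vwalk_arcs q) \<subseteq> parcs G \<union> Id" and "hd q = u" and "last q = v"
  shows "length p \<le> length q"
proof -
  obtain r where "path_between G u r v" "length r \<le> length q"
    using path_of_lazy_walk[OF assms(2-4)] assms(5,6) by auto
  \<comment> \<open>\<open>vwalk_length\<close> counts arcs, hence is \<open>length\<close> minus
    one, truncated at the empty list; nonemptiness of \<open>r\<close> restores the comparison of
    lengths.\<close>
  moreover from this have "length p - 1 \<le> length r - 1"
    using assms(1) by (auto simp: shortest_path_def)
  ultimately show ?thesis
    using assms(2) path_between_nonempty[of G u r v]
    by (cases r; cases q) auto
qed

section \<open>Isometric embeddings and dual general position sets\<close>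

lemma vwalk_arcs_map: "vwalk_arcs (map f p) = map (map_prod f f) (vwalk_arcs p)"
  by (induction p rule: vwalk_arcs.induct) auto

lemma internal_verts_map: "internal_verts (map f p) = f ` internal_verts p"
  by (simp add: internal_verts_def map_butlast[symmetric] map_tl[symmetric])

text \<open>The left inverse \<open>r\<close> of \<open>f\<close> sends arcs to arcs or to single
  vertices. It therefore turns any path from \<open>f u\<close> to \<open>f v\<close> into a lazy
  walk from \<open>u\<close> to \<open>v\<close> with equally many vertices, so no path in
  \<open>P\<close> can beat the image of \<open>p\<close>.\<close>

lemma shortest_path_map_retract:
  assumes f_verts: "f ` pverts H \<subseteq> pverts P"
    and f_arcs: "\<And>x y. (x, y) \<in> parcs H \<Longrightarrow> (f x, f y) \<in> parcs P"
    and r_verts: "r ` pverts P \<subseteq> pverts H"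
    and r_arcs: "\<And>x y. (x, y) \<in> parcs P \<Longrightarrow> (r x, r y) \<in> parcs H \<union> Id"
    and r_f: "\<And>x. x \<in> pverts H \<Longrightarrow> r (f x) = x"
    and p: "shortest_path H u p v"
  shows "shortest_path P (f u) (map f p) (f v)"
  unfolding shortest_path_def
proof (intro conjI allI impI)
  have walk: "set p \<subseteq> pverts H" "set (vwalk_arcs p) \<subseteq> parcs H" "p \<noteq> []" "distinct p"
    and ends: "hd p = u" "last p = v"
    using p by (auto simp: shortest_path_def path_between_def vpath_def vwalk_def)
  have inj: "inj_on f (pverts H)"
    by (rule inj_on_inverseI[of _ r]) (rule r_f)
  have uv: "u \<in> pverts H" "v \<in> pverts H"
    using walk ends by auto
  have fp: "set (map f p) \<subseteq> pverts P"
    using walk(1) f_verts by auto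
  have "map_prod f f ` parcs H \<subseteq> parcs P"
    using f_arcs by auto
  then have "set (vwalk_arcs (map f p)) \<subseteq> parcs P"
    using walk(2) by (auto simp: vwalk_arcs_map)
  then show "path_between P (f u) (map f p) (f v)"
    using walk ends fp inj
    by (simp add: path_between_def vpath_def vwalk_def hd_map last_map distinct_map
        inj_on_subset)
  fix q
  assume q: "path_between P (f u) q (f v)"
  then have qwalk: "set q \<subseteq> pverts P" "set (vwalk_arcs q) \<subseteq> parcs P" "q \<noteq> []"
      "hd q = f u" "last q = f v"
    by (auto simp: path_between_def vpath_def vwalk_def)
  have "map_prod r r ` parcs P \<subseteq> parcs H \<union> Id"
    using r_arcs by auto
  with qwalk(2) have "set (vwalk_arcs (map r q)) \<subseteq> parcs H \<union> Id"
    by (auto simp: vwalk_arcs_map)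
  then have "length p \<le> length (map r q)"
    using qwalk r_verts r_f uv
    by (intro shortest_path_le_lazy_walk[OF p]) (force simp: hd_map last_map)+
  then show "vwalk_length (map f p) \<le> vwalk_length q"
    by simp
qed

text \<open>Shortest paths of \<open>H\<close> map to shortest paths of \<open>P\<close>, so a
  shortest path with an internal vertex in the preimage of \<open>X\<close> would yield one in
  \<open>P\<close> with an internal vertex in \<open>X\<close>. This serves pairs inside and pairs
  outside the set alike.\<close>

lemma dual_gp_set_retract:
  assumes f_verts: "f ` pverts H \<subseteq> pverts P"
    and f_arcs: "\<And>x y. (x, y) \<in> parcs H \<Longrightarrow> (f x, f y) \<in> parcs P"
    and r_verts: "r ` pverts P \<subseteq> pverts H"
    and r_arcs: "\<And>x y. (x, y) \<in> parcs P \<Longrightarrow> (r x, r y) \<in> parcs H \<union> Id"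
    and r_f: "\<And>x. x \<in> pverts H \<Longrightarrow> r (f x) = x"
    and X: "dual_gp_set P X"
  shows "dual_gp_set H {x \<in> pverts H. f x \<in> X}"
proof -
  let ?Y = "{x \<in> pverts H. f x \<in> X}"
  have lift: "positionable H ?Y u v" if "positionable P X (f u) (f v)" for u v
    unfolding positionable_def
  proof (intro allI impI)
    fix p
    assume "shortest_path H u p v"
    then have "shortest_path P (f u) (map f p) (f v)"
      using shortest_path_map_retract[of f H P r, OF f_verts f_arcs r_verts r_arcs r_f] by blast
    then have "f ` internal_verts p \<inter> X = {}"
      using that unfolding positionable_def by (metis internal_verts_map)
    then show "internal_verts p \<inter> ?Y = {}"
      by auto
  qed
  \<comment> \<open>\<open>dual_gp_set\<close> constrains distinct pairs only, so the images must be
    distinct too.\<close>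
  have inj: "f u \<noteq> f v" if "u \<in> pverts H" "v \<in> pverts H" "u \<noteq> v" for u v
    using that r_f by metis
  show ?thesis
    unfolding dual_gp_set_def
  proof (intro conjI ballI impI)
    show "?Y \<subseteq> pverts H"
      by simp
  next
    fix u v
    assume "u \<in> ?Y" "v \<in> ?Y" "u \<noteq> v"
    then have "positionable P X (f u) (f v)"
      using X inj unfolding dual_gp_set_def by simp
    then show "positionable H ?Y u v"
      by (rule lift)
  next
    fix u v
    assume "u \<in> pverts H - ?Y" "v \<in> pverts H - ?Y" "u \<noteq> v"
    then have "f u \<in> pverts P - X" "f v \<in> pverts P - X" "f u \<noteq> f v"
      using inj f_verts by auto
    then have "positionable P X (f u) (f v)"
      using X unfolding dual_gp_set_def by simp
    then show "positionable H ?Y u v"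
      by (rule lift)
  qed
qed

section \<open>The maximum \<open>gp_dual\<close>: bound and attainment\<close>

lemma finite_dual_gp_set_cards:
  assumes "finite (pverts G)"
  shows "finite {card X | X. dual_gp_set G X}"
  by (rule finite_subset[of _ "card ` Pow (pverts G)"])
    (use assms in \<open>auto simp: dual_gp_set_def\<close>)

lemma card_le_gp_dual:
  assumes "finite (pverts G)" and "dual_gp_set G X"
  shows "card X \<le> gp_dual G"
  unfolding gp_dual_def using assms by (intro Max_ge finite_dual_gp_set_cards) auto

lemma gp_dual_attained:
  assumes "finite (pverts G)"
  obtains X where "dual_gp_set G X" "card X = gp_dual G"
proof -
  have "gp_dual G \<in> {card X | X. dual_gp_set G X}"
    \<comment> \<open>The empty set guarantees that \<open>Max\<close> ranges over a nonempty
      set.\<close>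
    unfolding gp_dual_def using dual_gp_set_empty[of G]
    by (intro Max_in finite_dual_gp_set_cards assms) auto
  then show thesis
    using that by auto
qed

section \<open>Simplicial vertices\<close>

lemma simplicial_iff:
  assumes "pair_graph G"
  shows "simplicial G v \<longleftrightarrow>
    v \<in> pverts G \<and>
    (\<forall>u w. (v, u) \<in> parcs G \<longrightarrow> (v, w) \<in> parcs G \<longrightarrow> u \<noteq> w \<longrightarrow> (u, w) \<in> parcs G)"
proof -
  interpret pair_graph G by fact
  let ?N = "neighbourhood G v"
  let ?I = "\<lparr> pverts = ?N, parcs = {e \<in> parcs G. fst e \<in> ?N \<and> snd e \<in> ?N} \<rparr>"
  have N: "u \<in> ?N \<longleftrightarrow> (v, u) \<in> parcs G" for u
    by (auto simp: neighbourhood_def dest: in_arcsD2)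
  have "finite ?N"
    by (simp add: neighbourhood_def pair_finite_verts)
  \<comment> \<open>The induced subgraph becomes an explicit pair digraph, the form to which
    \<open>complete_digraph_pair_def\<close> applies.\<close>
  have induced: "with_proj G \<restriction> ?N = with_proj ?I"
    by (simp add: with_proj_def induce_subgraph_def)
  show ?thesis
    unfolding simplicial_def induced complete_digraph_pair_def
    using \<open>finite ?N\<close> by (auto simp: N set_eq_iff dest: no_loops')
qed

text \<open>The two neighbours of an internal vertex \<open>x\<close> on the path are distinct,
  hence adjacent if \<open>x\<close> is simplicial; bypassing \<open>x\<close> would then shorten
  the path.\<close>

lemma simplicial_not_internal:
  assumes "pair_graph G" and "shortest_path G u p v" and "simplicial G x"
  shows "x \<notin> internal_verts p"
proof
  interpret pair_graph G by fact
  assume x: "x \<in> internal_verts p"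
  then obtain y ys where p: "p = y # ys" and "x \<in> set (butlast ys)"
    by (cases p) (auto simp: internal_verts_def)
  then obtain as bs where split: "butlast ys = as @ x # bs"
    by (meson split_list)
  then have "ys = as @ x # bs @ [last ys]"
    by (metis append.assoc append_Cons append_butlast_last_id butlast.simps(1) Nil_is_append_conv
        list.distinct(1))
  \<comment> \<open>\<open>internal_verts\<close> drops both ends of \<open>p\<close>: the head
    \<open>y\<close> makes \<open>cs\<close> nonempty, and \<open>last ys\<close> ensures a
    successor \<open>b\<close> of \<open>x\<close>.\<close>
  then obtain cs b ds where p_eq: "p = cs @ x # b # ds" and "cs \<noteq> []"
    using p by (cases "bs @ [last ys]") (auto intro!: that[of "y # as"])
  then obtain cs' a where "cs = cs' @ [a]"
    by (cases cs rule: rev_cases) auto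
  with p_eq have p_eq: "p = cs' @ [a, x, b] @ ds"
    by simp
  have walk: "set p \<subseteq> pverts G" "set (vwalk_arcs p) \<subseteq> parcs G" "distinct p"
    and ends: "hd p = u" "last p = v"
    using assms(2) by (auto simp: shortest_path_def path_between_def vpath_def vwalk_def)
  have arcs: "(a, x) \<in> parcs G" "(x, b) \<in> parcs G"
    using walk(2) set_vwalk_arcs_append1[of "[a, x, b]" ds]
      set_vwalk_arcs_append2[of "[a, x, b] @ ds" cs'] by (auto simp: p_eq)
  have "a \<noteq> b"
    using walk(3) by (simp add: p_eq)
  then have ab: "(a, b) \<in> parcs G"
    using arcs(2) arcs_symmetric[OF arcs(1)] assms(3) simplicial_iff[OF assms(1)] by blast
  let ?q = "cs' @ a # b # ds"
  have "set (vwalk_arcs ?q) \<subseteq> insert (a, b) (set (vwalk_arcs p))"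
    by (cases "cs' = []") (simp_all add: p_eq vwalk_arcs_append insert_commute subset_insertI2)
  then have "length p \<le> length ?q"
    using walk ends ab
    by (intro shortest_path_le_lazy_walk[OF assms(2)]) (auto simp: p_eq hd_append)
  then show False
    by (simp add: p_eq)
qed

lemma dual_gp_set_simplicial:
  assumes "pair_graph G" and "\<And>x. x \<in> X \<Longrightarrow> simplicial G x"
  shows "dual_gp_set G X"
proof -
  have "X \<subseteq> pverts G"
    using assms(2) by (auto simp: simplicial_def)
  moreover have "internal_verts p \<inter> X = {}" if "shortest_path G u p v" for u p v
    using simplicial_not_internal[OF assms(1) that] assms(2) by blast
  ultimately show ?thesis
    unfolding dual_gp_set_def positionable_def by blast
qed

text \<open>Stated for closed neighbourhoods because an arc of the strong product may leave one
  coordinate fixed.\<close>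

lemma simplicial_closed_neighbourhood:
  assumes "pair_graph G" and "simplicial G v"
    and "v = u \<or> (v, u) \<in> parcs G" and "v = w \<or> (v, w) \<in> parcs G"
  shows "u = w \<or> (u, w) \<in> parcs G"
proof -
  interpret pair_graph G by fact
  show ?thesis
    using assms(2-) arcs_symmetric[of v u] unfolding simplicial_iff[OF assms(1)] by blast
qed

text \<open>Closed neighbourhoods in the strong product are products of closed neighbourhoods, and a
  product of two cliques is a clique.\<close>

lemma simplicial_strong_product:
  assumes "pair_graph G" and "pair_graph H" and g: "simplicial G g" and h: "simplicial H h"
  shows "simplicial (G \<boxtimes> H) (g, h)"
  unfolding simplicial_iff[OF pair_graph_strong_product[OF assms(1,2)]]
proof (intro conjI allI impI)
  show "(g, h) \<in> pverts (G \<boxtimes> H)"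
    using g h by (simp add: simplicial_def strong_product_def)
  fix u w
  assume u: "((g, h), u) \<in> parcs (G \<boxtimes> H)" and w: "((g, h), w) \<in> parcs (G \<boxtimes> H)"
    and "u \<noteq> w"
  have "g = fst x \<or> (g, fst x) \<in> parcs G" "h = snd x \<or> (h, snd x) \<in> parcs H"
      "fst x \<in> pverts G" "snd x \<in> pverts H"
    if "((g, h), x) \<in> parcs (G \<boxtimes> H)" for x
    using that by (auto simp: strong_product_def)
  with u w have "fst u = fst w \<or> (fst u, fst w) \<in> parcs G" "snd u = snd w \<or> (snd u, snd w) \<in> parcs H"
      "{fst u, fst w} \<subseteq> pverts G" "{snd u, snd w} \<subseteq> pverts H"
    using simplicial_closed_neighbourhood[OF assms(1) g, of "fst u" "fst w"]
      simplicial_closed_neighbourhood[OF assms(2) h, of "snd u" "snd w"]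
    by simp_all
  with \<open>u \<noteq> w\<close> show "(u, w) \<in> parcs (G \<boxtimes> H)"
    by (auto simp: strong_product_def split_beta prod_eq_iff)
qed

section \<open>Non-adjacent neighbours and the bound by simplicial vertices\<close>

lemma dual_gp_set_neighbours:
  assumes "pair_graph G" and "dual_gp_set G X" and "x \<in> X"
    and "(u, x) \<in> parcs G" and "(x, w) \<in> parcs G" and "u \<noteq> w" and "(u, w) \<notin> parcs G"
  shows "u \<in> X \<longleftrightarrow> w \<notin> X"
proof (rule ccontr)
  interpret pair_graph G by fact
  assume same: "\<not> ?thesis"
  have verts: "u \<in> pverts G" "x \<in> pverts G" "w \<in> pverts G"
    using assms in_arcsD1 in_arcsD2 by blast+
  have "path_between G u [u, x, w] w"
    using assms verts by (auto dest: no_loops')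
  \<comment> \<open>One vertex would force \<open>u = w\<close>, two would force the arc
    \<open>(u, w)\<close>; \<open>remdups_adj.cases\<close> merely splits lists into these
    shapes.\<close>
  moreover have "3 \<le> length q" if "path_between G u q w" for q
    using that assms(6,7)
    by (cases q rule: remdups_adj.cases; cases "tl (tl q)")
      (auto dest: path_between_nonempty)
  ultimately have "shortest_path G u [u, x, w] w"
    by (fastforce simp: shortest_path_def simp del: path_between_Cons2)
  \<comment> \<open>By \<open>same\<close>, both ends lie in \<open>X\<close> or both lie outside
    it, while the middle vertex \<open>x\<close> is in \<open>X\<close>.\<close>
  moreover have "positionable G X u w"
    using same assms(2,6) verts unfolding dual_gp_set_def by blast
  ultimately show False
    using assms(3) by (auto simp: positionable_def internal_verts_def)
qed

lemma dual_gp_set_strong_product_simplicial: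
  assumes "pair_graph G" and "pair_graph H" and X: "dual_gp_set (G \<boxtimes> H) X" and gh: "(g, h) \<in> X"
  shows "simplicial G g \<or> simplicial H h"
proof (rule ccontr)
  interpret G: pair_graph G by fact
  interpret H: pair_graph H by fact
  assume nonsimplicial: "\<not> ?thesis"
  have "g \<in> pverts G" "h \<in> pverts H"
    using X gh by (auto simp: dual_gp_set_def strong_product_def)
  then obtain g1 g2 h1 h2
    where g: "(g, g1) \<in> parcs G" "(g, g2) \<in> parcs G" "g1 \<noteq> g2" "(g1, g2) \<notin> parcs G"
      and h: "(h, h1) \<in> parcs H" "(h, h2) \<in> parcs H" "h1 \<noteq> h2" "(h1, h2) \<notin> parcs H"
    using nonsimplicial by (auto simp: simplicial_iff assms(1,2))
  have sym: "(g2, g1) \<notin> parcs G" "(h2, h1) \<notin> parcs H"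
      "(g1, g) \<in> parcs G" "(g2, g) \<in> parcs G" "(h1, h) \<in> parcs H" "(h2, h) \<in> parcs H"
    using g h by (blast intro: G.arcs_symmetric H.arcs_symmetric)+
  \<comment> \<open>Distinct members of the square differ in some coordinate, and there they are
    non-adjacent, which rules out an arc of the product.\<close>
  have opposite: "u \<in> X \<longleftrightarrow> w \<notin> X"
    if "u \<in> {g1, g2} \<times> {h1, h2}" "w \<in> {g1, g2} \<times> {h1, h2}" "u \<noteq> w" for u w
  proof (rule dual_gp_set_neighbours[OF pair_graph_strong_product[OF assms(1,2)] X gh])
    show "(u, g, h) \<in> parcs (G \<boxtimes> H)" "((g, h), w) \<in> parcs (G \<boxtimes> H)"
      using that g h sym
      by (auto simp: strong_product_def dest: G.wellformed' H.wellformed')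
    show "(u, w) \<notin> parcs (G \<boxtimes> H)"
      using that g h sym
      by (auto simp: strong_product_def dest: G.no_loops' H.no_loops')
  qed fact
  \<comment> \<open>Pigeonhole: of three vertices, two lie on the same side of
    \<open>X\<close>.\<close>
  show False
    using opposite[of "(g1, h1)" "(g1, h2)"] opposite[of "(g1, h1)" "(g2, h1)"]
      opposite[of "(g1, h2)" "(g2, h1)"] g(3) h(3)
    by auto
qed

lemma card_dual_gp_set_strong_product_simplicial:
  assumes "pair_graph G" and "pair_graph H" and X: "dual_gp_set (G \<boxtimes> H) X"
  shows "card X \<le> num_simplicial G * card (pverts H) + num_simplicial H * card (pverts G)
    - num_simplicial G * num_simplicial H"
proof -
  interpret G: pair_graph G by fact
  interpret H: pair_graph H by fact
  let ?S = "{g. simplicial G g}" and ?T = "{h. simplicial H h}"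
  let ?A = "?S \<times> pverts H" and ?B = "pverts G \<times> ?T"
  have sub: "?S \<subseteq> pverts G" "?T \<subseteq> pverts H"
    by (auto simp: simplicial_def)
  have fin: "finite ?A" "finite ?B"
    using finite_subset[OF sub(1)] finite_subset[OF sub(2)] by simp_all
  have "X \<subseteq> ?A \<union> ?B"
    using dual_gp_set_strong_product_simplicial[OF assms] X
    by (fastforce simp: dual_gp_set_def strong_product_def)
  then have "card X \<le> card (?A \<union> ?B)"
    using fin by (intro card_mono) auto
  moreover have "?A \<inter> ?B = ?S \<times> ?T"
    using sub by auto
  \<comment> \<open>Inclusion-exclusion in additive form makes the truncated subtraction in the goal
    exact.\<close>
  then have "card ?A + card ?B = card (?A \<union> ?B) + card (?S \<times> ?T)"
    using card_Un_Int[OF fin] by simp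
  ultimately show ?thesis
    by (simp add: num_simplicial_def card_cartesian_product mult.commute)
qed

section \<open>Counting along the layers of the product\<close>

lemma card_le_fibres:
  assumes "finite A" and "finite X" and "f ` X \<subseteq> A"
    and "\<And>a. a \<in> A \<Longrightarrow> card {x \<in> X. f x = a} \<le> k"
  shows "card X \<le> card A * k"
proof -
  have "card X = (\<Sum>a\<in>A. card {x \<in> X. f x = a})"
    using sum.group[OF assms(2,1,3), of "\<lambda>_. 1 :: nat"] by simp
  also have "\<dots> \<le> card A * k"
    using sum_bounded_above[of A "\<lambda>a. card {x \<in> X. f x = a}" k] assms(4) by simp
  finally show ?thesis .
qed

lemma card_dual_gp_set_strong_product_right:
  assumes "pair_graph G" and "pair_graph H" and X: "dual_gp_set (G \<boxtimes> H) X"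
  shows "card X \<le> card (pverts G) * gp_dual H"
proof -
  interpret G: pair_graph G by fact
  interpret H: pair_graph H by fact
  have sub: "X \<subseteq> pverts G \<times> pverts H"
    using X by (simp add: dual_gp_set_def strong_product_def)
  show ?thesis
  proof (rule card_le_fibres[where f = fst])
    show "finite (pverts G)"
      by (rule G.pair_finite_verts)
    show "finite X"
      by (rule finite_subset[OF sub]) (simp add: G.pair_finite_verts H.pair_finite_verts)
    show "fst ` X \<subseteq> pverts G"
      using sub by auto
    fix g
    assume g: "g \<in> pverts G"
    have "dual_gp_set H {h \<in> pverts H. (g, h) \<in> X}"
      \<comment> \<open>Here \<open>f\<close> is the embedding \<open>Pair g\<close> onto the layer
        over \<open>g\<close>; \<open>snd\<close> inverts it, and arcs of the product with equal
        second coordinates give the \<open>Id\<close> case.\<close>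
      by (rule dual_gp_set_retract[where r = snd, OF _ _ _ _ _ X])
        (use g in \<open>auto simp: strong_product_def dest: H.wellformed'\<close>)
    moreover have "{x \<in> X. fst x = g} = Pair g ` {h \<in> pverts H. (g, h) \<in> X}"
      using sub by auto
    ultimately show "card {x \<in> X. fst x = g} \<le> gp_dual H"
      using card_le_gp_dual[OF H.pair_finite_verts] by (simp add: card_image inj_on_def)
  qed
qed

lemma card_dual_gp_set_strong_product_left:
  assumes "pair_graph G" and "pair_graph H" and X: "dual_gp_set (G \<boxtimes> H) X"
  shows "card X \<le> card (pverts H) * gp_dual G"
proof -
  interpret G: pair_graph G by fact
  interpret H: pair_graph H by fact
  have sub: "X \<subseteq> pverts G \<times> pverts H"
    using X by (simp add: dual_gp_set_def strong_product_def)
  show ?thesis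
  proof (rule card_le_fibres[where f = snd])
    show "finite (pverts H)"
      by (rule H.pair_finite_verts)
    show "finite X"
      by (rule finite_subset[OF sub]) (simp add: G.pair_finite_verts H.pair_finite_verts)
    show "snd ` X \<subseteq> pverts H"
      using sub by auto
    fix h
    assume h: "h \<in> pverts H"
    have "dual_gp_set G {g \<in> pverts G. (g, h) \<in> X}"
      \<comment> \<open>The mirror image: the layer at height \<open>h\<close> is a copy of
        \<open>G\<close>, with \<open>fst\<close> as the retraction.\<close>
      by (rule dual_gp_set_retract[where r = fst, OF _ _ _ _ _ X])
        (use h in \<open>auto simp: strong_product_def dest: G.wellformed'\<close>)
    moreover have "{x \<in> X. snd x = h} = (\<lambda>g. (g, h)) ` {g \<in> pverts G. (g, h) \<in> X}"
      using sub by auto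
    ultimately show "card {x \<in> X. snd x = h} \<le> gp_dual G"
      using card_le_gp_dual[OF G.pair_finite_verts] by (simp add: card_image inj_on_def)
  qed
qed

theorem theorem4p6:
  fixes G :: "'a pair_pre_digraph" and H :: "'b pair_pre_digraph"
  assumes "pair_graph G" and "connected (with_proj G)"
    and "pair_graph H" and "connected (with_proj H)"
  shows "num_simplicial G * num_simplicial H \<le> gp_dual (G \<boxtimes> H) \<and>
    gp_dual (G \<boxtimes> H) \<le>
      Min {num_simplicial G * card (pverts H) + num_simplicial H * card (pverts G)
             - num_simplicial G * num_simplicial H,
           card (pverts G) * gp_dual H,
           card (pverts H) * gp_dual G}"
proof -
  note GH = assms(1,3)
  interpret P: pair_graph "G \<boxtimes> H"
    using GH by (rule pair_graph_strong_product)
  have "dual_gp_set (G \<boxtimes> H) ({g. simplicial G g} \<times> {h. simplicial H h})"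
    using GH by (auto intro!: dual_gp_set_simplicial simplicial_strong_product P.pair_graph_axioms)
  from card_le_gp_dual[OF P.pair_finite_verts this]
  have "num_simplicial G * num_simplicial H \<le> gp_dual (G \<boxtimes> H)"
    by (simp add: num_simplicial_def card_cartesian_product)
  \<comment> \<open>The three upper bounds hold for every dual general position set, so they are
    applied to a largest one.\<close>
  moreover obtain X where X: "dual_gp_set (G \<boxtimes> H) X" "card X = gp_dual (G \<boxtimes> H)"
    using gp_dual_attained[OF P.pair_finite_verts] by blast
  ultimately show ?thesis
    using card_dual_gp_set_strong_product_simplicial[OF GH X(1)]
      card_dual_gp_set_strong_product_right[OF GH X(1)]
      card_dual_gp_set_strong_product_left[OF GH X(1)]
    by simp
qed

end
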